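(* Every finite graph $G$ on $n$ vertices is (isomorphic to) an induced subgraph of some very well-covered graph $H$ such that the sequence of coefficients of the independence polynomial $i(H,x)$ is unimodal.
   Context: Graphs are finite, simple and undirected. A set of vertices is independent if it induces no edges. The independence polynomial of a graph $H$ is $i(H,x)=\sum_{j=0}^{\alpha(H)} i_j x^j$, where $i_j$ is the number of independent sets of size $j$ in $H$ and $\alpha(H)$ is the maximum size of an independent set. A graph with $N$ vertices is very well-covered if every maximal (with respect to inclusion) independent set has size exactly $N/2$. A finite sequence $\langle a_0,\ldots,a_d\rangle$ is unimodal if it is nondecreasing and then nonincreasing, i.e. there is an index $m$ with $a_0\le a_1\le\cdots\le a_m\ge a_{m+1}\ge\cdots\ge a_d$. *)

theory Defs
  imports
    "HOL-Computational_Algebra.Polynomial"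
    "Graph_Theory.Graph_Theory"
begin

text \<open>
  A finite simple undirected graph is represented by the locale \<open>pair_graph\<close> of
  \<open>Graph_Theory\<close>: a finite vertex set with a finite, symmetric, loop-free arc relation,
  the undirected edge \<open>uv\<close> being the two arcs \<open>(u, v)\<close> and \<open>(v, u)\<close>.  The definitions
  below are meant for such graphs.
\<close>

definition indep_set :: "'a pair_pre_digraph \<Rightarrow> 'a set \<Rightarrow> bool" where
  "indep_set G S \<longleftrightarrow> S \<subseteq> pverts G \<and> (\<forall>u\<in>S. \<forall>v\<in>S. (u, v) \<notin> parcs G)"

definition maximal_indep_set :: "'a pair_pre_digraph \<Rightarrow> 'a set \<Rightarrow> bool" where
  "maximal_indep_set G S \<longleftrightarrow>
     indep_set G S \<and> (\<forall>T. indep_set G T \<and> S \<subseteq> T \<longrightarrow> T = S)"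

definition indep_number :: "'a pair_pre_digraph \<Rightarrow> nat" where
  "indep_number G = Max (card ` {S. indep_set G S})"

definition num_indep_sets :: "'a pair_pre_digraph \<Rightarrow> nat \<Rightarrow> nat" where
  "num_indep_sets G j = card {S. indep_set G S \<and> card S = j}"

definition indep_poly :: "'a pair_pre_digraph \<Rightarrow> nat poly" where
  "indep_poly G = (\<Sum>j\<le>indep_number G. monom (num_indep_sets G j) j)"

text \<open>
  Size \<open>N / 2\<close> is written without division, so a graph with an odd number \<open>N\<close> of vertices
  is never very well-covered.
\<close>

definition very_well_covered :: "'a pair_pre_digraph \<Rightarrow> bool" where
  "very_well_covered G \<longleftrightarrow>
     (\<forall>S. maximal_indep_set G S \<longrightarrow> 2 * card S = card (pverts G))"

definition unimodal :: "'b::linorder list \<Rightarrow> bool" where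
  "unimodal a \<longleftrightarrow> (\<exists>m<length a.
     (\<forall>i. i < m \<longrightarrow> a ! i \<le> a ! Suc i) \<and>
     (\<forall>i. m \<le> i \<and> Suc i < length a \<longrightarrow> a ! Suc i \<le> a ! i))"

end

theory Submission
  imports Defs
begin

text \<open>
  Take the corona of \<open>G\<close> with \<open>K\<^sub>1\<close> and replace every pendant edge \<open>v v'\<close> by a copy of
  \<open>K\<^bsub>r,r\<^esub>\<close>. The maximal independent sets of the resulting graph \<open>H\<close> correspond to the independent
  sets \<open>T\<close> of \<open>G\<close>: they consist of the \<open>v\<close>-sides for \<open>v \<in> T\<close> and of the \<open>v'\<close>-sides for \<open>v \<notin> T\<close>,
  hence have size \<open>M = n r\<close>, half the number of vertices, and two of them share at most
  \<open>m = (n - 1) r\<close> vertices.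

  Let \<open>a\<^sub>k\<close> be the number of independent \<open>k\<close>-sets of \<open>H\<close> and \<open>N\<close> the number of independent sets of
  \<open>G\<close>. Double counting gives \<open>(M - k) a\<^sub>k \<le> (k + 1) a\<^bsub>k+1\<^esub>\<close>, so the coefficients increase up to the
  middle. Past the middle, \<open>a\<^sub>k\<close> lies between \<open>N (M choose k) - N\<^sup>2 (m choose k)\<close> and
  \<open>N (M choose k)\<close>; there \<open>m choose k \<le> (1 - 1/n)\<^sup>k (M choose k)\<close> is negligible
  against \<open>(M choose k) - (M choose (k + 1))\<close> once \<open>r\<close> is large, so the coefficients decrease.
\<close>

section \<open>Counting the faces of a complex generated by sets of equal size\<close>

text \<open>The \<open>k\<close>-element faces of the simplicial complex generated by
  \<open>F\<close>. For the independence complex of a graph these are the independent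
  \<open>k\<close>-sets, so the counting can be done without graphs.\<close>

definition faces :: "'a set set \<Rightarrow> nat \<Rightarrow> 'a set set" where
  "faces F k = {S. card S = k \<and> (\<exists>X\<in>F. S \<subseteq> X)}"

lemma faces_eq_UN: "faces F k = (\<Union>X\<in>F. {S. S \<subseteq> X \<and> card S = k})"
  by (auto simp: faces_def)

lemma finite_faces: "finite F \<Longrightarrow> (\<And>X. X \<in> F \<Longrightarrow> finite X) \<Longrightarrow> finite (faces F k)"
  by (simp add: faces_eq_UN)

lemma card_faces_le:
  assumes "finite F" "\<And>X. X \<in> F \<Longrightarrow> finite X \<and> card X = M"
  shows "card (faces F k) \<le> card F * (M choose k)"
proof -
  have "card (faces F k) \<le> (\<Sum>X\<in>F. card {S. S \<subseteq> X \<and> card S = k})"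
    unfolding faces_eq_UN by (rule card_UN_le[OF assms(1)])
  also have "\<dots> = card F * (M choose k)"
    using assms(2) by (simp add: n_subsets)
  finally show ?thesis .
qed

text \<open>A Bonferroni-type bound, by adding one generator at a time. A \<open>k\<close>-set
  inside the new \<open>X\<close> that was already counted lies in some \<open>X \<inter> Y\<close>,
  so at most \<open>card F * (m choose k)\<close> sets are lost in each step. The loss stands on the
  right to avoid truncated subtraction.\<close>

lemma card_faces_ge:
  assumes "finite F" "\<And>X. X \<in> F \<Longrightarrow> finite X \<and> card X = M"
    and "\<And>X Y. X \<in> F \<Longrightarrow> Y \<in> F \<Longrightarrow> X \<noteq> Y \<Longrightarrow> card (X \<inter> Y) \<le> m"
  shows "card F * (M choose k) \<le> card (faces F k) + (card F)\<^sup>2 * (m choose k)"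
  using assms
proof (induction F rule: finite_induct)
  case empty
  then show ?case by simp
next
  case (insert X F)
  let ?A = "\<lambda>X. {S. S \<subseteq> X \<and> card S = k}"
  have IH: "card F * (M choose k) \<le> card (faces F k) + (card F)\<^sup>2 * (m choose k)"
    using insert.prems by (intro insert.IH) auto
  have X: "finite X" "card X = M" using insert.prems by auto
  have "?A X \<inter> faces F k \<subseteq> (\<Union>Y\<in>F. ?A (X \<inter> Y))"
    by (auto simp: faces_def)
  then have "card (?A X \<inter> faces F k) \<le> card (\<Union>Y\<in>F. ?A (X \<inter> Y))"
    using X insert.hyps by (intro card_mono) auto
  also have "\<dots> \<le> (\<Sum>Y\<in>F. card (?A (X \<inter> Y)))"
    by (rule card_UN_le) fact
  also have "\<dots> = (\<Sum>Y\<in>F. card (X \<inter> Y) choose k)"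
    using X by (intro sum.cong refl n_subsets) simp
  also have "\<dots> \<le> (\<Sum>Y\<in>F. m choose k)"
    using insert.hyps by (intro sum_mono binomial_right_mono insert.prems(2)) auto
  finally have overlap: "card (?A X \<inter> faces F k) \<le> card F * (m choose k)"
    by simp
  have fin: "finite (faces F k)"
    using insert.prems insert.hyps by (intro finite_faces) auto
  have "faces (insert X F) k = ?A X \<union> faces F k"
    by (auto simp: faces_def)
  then have "card (faces (insert X F) k) + card (?A X \<inter> faces F k) = (M choose k) + card (faces F k)"
    using card_Un_Int[OF _ fin, of "?A X"] X by (simp add: n_subsets)
  with overlap IH insert.hyps show ?case
    by (simp add: power2_eq_square algebra_simps)
qed

text \<open>Count the pairs \<open>S \<subseteq> T\<close> of faces of sizes \<open>k\<close> and
  \<open>Suc k\<close>: each \<open>T\<close> contains \<open>Suc k\<close> such \<open>S\<close>,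
  and each \<open>S\<close> lies in a generator of size \<open>M\<close>, hence extends in at least
  \<open>M - k\<close> ways.\<close>

lemma faces_double_count:
  assumes "finite F" "\<And>X. X \<in> F \<Longrightarrow> finite X \<and> card X = M"
  shows "(M - k) * card (faces F k) \<le> Suc k * card (faces F (Suc k))"
proof -
  have finite_face: "finite S" if "S \<in> faces F j" for S j
    using that assms(2) finite_subset by (auto simp: faces_def)
  have below: "card {S \<in> faces F k. S \<subseteq> T} = Suc k" if T: "T \<in> faces F (Suc k)" for T
  proof -
    have "{S \<in> faces F k. S \<subseteq> T} = {S. S \<subseteq> T \<and> card S = k}"
      using T by (auto simp: faces_def)
    then show ?thesis
      using T finite_face[OF T] by (simp add: n_subsets faces_def)
  qed
  have above: "M - k \<le> card {T \<in> faces F (Suc k). S \<subseteq> T}" if S: "S \<in> faces F k" for S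
  proof -
    obtain X where X: "X \<in> F" "S \<subseteq> X" "card S = k" using S by (auto simp: faces_def)
    have fS: "finite S" using finite_face[OF S] .
    have "M - k = card ((\<lambda>x. insert x S) ` (X - S))"
      using X fS assms(2) by (subst card_image) (auto simp: inj_on_def card_Diff_subset)
    also have "\<dots> \<le> card {T \<in> faces F (Suc k). S \<subseteq> T}"
      using X fS assms by (intro card_mono) (auto simp: faces_def intro!: finite_faces[unfolded faces_def])
    finally show ?thesis .
  qed
  have "(M - k) * card (faces F k) = (\<Sum>S\<in>faces F k. M - k)" by simp
  also have "\<dots> \<le> (\<Sum>S\<in>faces F k. card {T \<in> faces F (Suc k). S \<subseteq> T})"
    by (rule sum_mono) (rule above)
  also have "\<dots> = (\<Sum>T\<in>faces F (Suc k). Suc k)"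
    using assms below by (intro sum_multicount_gen ballI finite_faces) auto
  finally show ?thesis by (simp add: mult.commute)
qed

section \<open>Binomial estimates and the choice of the blow-up factor\<close>

lemma Suc_times_choose_Suc: "Suc k * (m choose Suc k) = (m choose k) * (m - k)"
  by (metis binomial_absorb_comp binomial_absorption mult.commute)

text \<open>Raising \<open>k\<close> by one multiplies the binomials by
  \<open>(m - k) / (k + 1)\<close> and \<open>(M - k) / (k + 1)\<close>, and the first factor is at
  most \<open>p / n\<close> times the second. The powers of \<open>n\<close> and \<open>p\<close>
  clear the denominators.\<close>

lemma choose_decay:
  assumes "m * n \<le> p * M" "m \<le> M" "p \<le> n"
  shows "n ^ k * (m choose k) \<le> p ^ k * (M choose k)"
proof (induction k)
  case 0
  then show ?case by simp
next
  case (Suc k)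
  have step: "n * (m - k) \<le> p * (M - k)"
  proof (cases "k \<le> m")
    case True
    have "n * (m - k) = m * n - n * k" by (simp add: diff_mult_distrib2 mult.commute)
    also have "\<dots> \<le> p * M - p * k" using assms(1) mult_right_mono[OF assms(3), of k] by linarith
    finally show ?thesis by (simp add: diff_mult_distrib2)
  qed simp
  have "Suc k * (n ^ Suc k * (m choose Suc k)) = n ^ Suc k * (Suc k * (m choose Suc k))"
    by (rule mult.left_commute)
  also have "\<dots> = (n ^ k * (m choose k)) * (n * (m - k))"
    by (simp only: Suc_times_choose_Suc power_Suc2 mult_ac)
  also have "\<dots> \<le> (p ^ k * (M choose k)) * (p * (M - k))"
    by (rule mult_mono[OF Suc.IH step]) simp_all
  also have "\<dots> = p ^ Suc k * (Suc k * (M choose Suc k))"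
    by (simp only: Suc_times_choose_Suc power_Suc2 mult_ac)
  also have "\<dots> = Suc k * (p ^ Suc k * (M choose Suc k))"
    by (rule mult.left_commute)
  finally show ?case by (simp only: Suc_mult_le_cancel1)
qed

text \<open>By \<open>choose_decay\<close> the left binomial is at most \<open>q ^ k\<close> times
  the right one, where \<open>q = (n - 1) / n < 1\<close>, and \<open>N * Suc k * q ^ k\<close>
  tends to \<open>0\<close>. A large \<open>r\<close> makes every \<open>k\<close> in the upper half
  large.\<close>

lemma exists_blowup_factor:
  fixes n N :: nat
  assumes "n > 0"
  shows "\<exists>r>0. \<forall>k. n * r \<le> 2 * k \<longrightarrow>
           N * Suc k * ((n - 1) * r choose k) \<le> (n * r choose k)"
proof -
  define q :: real where "q = real (n - 1) / real n"
  have q: "0 \<le> q" "q < 1" using assms by (auto simp: q_def)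
  have "(\<lambda>k. real N * (real k * q ^ k + q ^ k)) \<longlonglongrightarrow> real N * (0 + 0)"
    using q by (intro tendsto_intros powser_times_n_limit_0 LIMSEQ_power_zero) auto
  then have "eventually (\<lambda>k. real N * (real k * q ^ k + q ^ k) < 1) sequentially"
    by (rule order_tendstoD) simp
  then obtain K where K: "real N * (real k * q ^ k + q ^ k) < 1" if "k \<ge> K" for k
    by (auto simp: eventually_sequentially)
  \<comment> \<open>As \<open>n \<ge> 1\<close>, the condition \<open>n * r \<le> 2 * k\<close>
    gives \<open>2 * K + 1 \<le> 2 * k\<close>, which places \<open>k\<close> beyond
    \<open>K\<close>; the summand \<open>1\<close> also keeps \<open>r\<close> positive.\<close>
  define r where "r = 2 * K + 1"
  have "N * Suc k * ((n - 1) * r choose k) \<le> (n * r choose k)" if k: "n * r \<le> 2 * k" for k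
  proof -
    have "r \<le> n * r" using assms by simp
    with k have "K \<le> k" by (simp add: r_def)
    have "n ^ k * ((n - 1) * r choose k) \<le> (n - 1) ^ k * (n * r choose k)"
      by (rule choose_decay) (auto simp: mult.assoc mult.left_commute mult.commute)
    then have "real n ^ k * real ((n - 1) * r choose k) \<le> real (n - 1) ^ k * real (n * r choose k)"
      by (metis of_nat_le_iff of_nat_mult of_nat_power)
    then have "real ((n - 1) * r choose k) \<le> q ^ k * real (n * r choose k)"
      using assms by (simp add: q_def power_divide field_simps)
    then have "real (N * Suc k) * real ((n - 1) * r choose k)
        \<le> real (N * Suc k) * (q ^ k * real (n * r choose k))"
      by (rule mult_left_mono) simp
    also have "\<dots> = (real N * (real k * q ^ k + q ^ k)) * real (n * r choose k)"
      by (simp add: algebra_simps)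
    also have "\<dots> \<le> 1 * real (n * r choose k)"
      using K[OF \<open>K \<le> k\<close>] by (intro mult_right_mono) auto
    finally show ?thesis
      by (metis mult_1 of_nat_le_iff of_nat_mult)
  qed
  then show ?thesis by (intro exI[of _ r]) (auto simp: r_def)
qed

section \<open>Monotonicity of the face numbers on either side of the middle\<close>

text \<open>The bound on \<open>k\<close> amounts to \<open>Suc k \<le> M - k\<close>, so
  \<open>Suc k\<close> cancels from the double count.\<close>

lemma card_faces_incr:
  assumes "finite F" "\<And>X. X \<in> F \<Longrightarrow> finite X \<and> card X = M" and "2 * Suc k \<le> Suc M"
  shows "card (faces F k) \<le> card (faces F (Suc k))"
proof -
  have "Suc k * card (faces F k) \<le> (M - k) * card (faces F k)"
    using assms(3) by (intro mult_right_mono) auto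
  also have "\<dots> \<le> Suc k * card (faces F (Suc k))"
    using assms by (intro faces_double_count) auto
  finally show ?thesis by (simp only: Suc_mult_le_cancel1)
qed

text \<open>With \<open>N = card F\<close>, the two bounds on face numbers reduce the claim to
  \<open>(M choose Suc k) + N * (m choose k) \<le> (M choose k)\<close>. Since
  \<open>Suc k * (M choose Suc k) = (M - k) * (M choose k)\<close> and
  \<open>M - k + 1 \<le> Suc k\<close>, the drop between the binomials, times \<open>Suc k\<close>,
  is at least \<open>M choose k\<close>, and by \<open>gap\<close> this dominates the overlap
  term.\<close>

lemma card_faces_decr:
  assumes "finite F" "\<And>X. X \<in> F \<Longrightarrow> finite X \<and> card X = M"
    and "\<And>X Y. X \<in> F \<Longrightarrow> Y \<in> F \<Longrightarrow> X \<noteq> Y \<Longrightarrow> card (X \<inter> Y) \<le> m"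
    and "M \<le> 2 * k" "k \<le> M"
    and gap: "card F * Suc k * (m choose k) \<le> (M choose k)"
  shows "card (faces F (Suc k)) \<le> card (faces F k)"
proof -
  have "Suc k * (M choose Suc k) + (M choose k) = (M - k + 1) * (M choose k)"
    by (simp add: Suc_times_choose_Suc[simplified] algebra_simps)
  also have "\<dots> \<le> Suc k * (M choose k)"
    using assms(4) by (intro mult_right_mono) auto
  finally have "Suc k * (M choose Suc k) + Suc k * (card F * (m choose k)) \<le> Suc k * (M choose k)"
    using gap by (simp add: algebra_simps)
  then have "(M choose Suc k) + card F * (m choose k) \<le> (M choose k)"
    by (simp only: add_mult_distrib2[symmetric] Suc_mult_le_cancel1)
  then have "card F * ((M choose Suc k) + card F * (m choose k)) \<le> card F * (M choose k)"
    by (rule mult_left_mono) simp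
  with card_faces_le[of F M "Suc k"] card_faces_ge[of F M m k] assms(1-3)
  show ?thesis by (simp add: power2_eq_square algebra_simps)
qed

section \<open>Graphs whose independence complex is pure\<close>

context
  fixes H :: "'a pair_pre_digraph" and F :: "'a set set" and M :: nat
  assumes indep_iff: "\<And>S. indep_set H S \<longleftrightarrow> (\<exists>X\<in>F. S \<subseteq> X)"
    and F: "finite F" "F \<noteq> {}" "\<And>X. X \<in> F \<Longrightarrow> finite X \<and> card X = M"
begin

lemma num_indep_sets_eq_card_faces: "num_indep_sets H k = card (faces F k)"
  unfolding num_indep_sets_def faces_def indep_iff by (rule arg_cong[of _ _ card]) auto

lemma card_maximal_indep_set:
  assumes "maximal_indep_set H S"
  shows "card S = M"
proof -
  obtain X where "X \<in> F" "S \<subseteq> X"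
    using assms by (auto simp: maximal_indep_set_def indep_iff)
  moreover from this have "X = S"
    using assms unfolding maximal_indep_set_def indep_iff by blast
  ultimately show ?thesis using F(3) by blast
qed

lemma indep_number_eq: "indep_number H = M"
  unfolding indep_number_def
proof (rule Max_eqI)
  have "{S. indep_set H S} = (\<Union>X\<in>F. Pow X)"
    by (auto simp: indep_iff)
  then show "finite (card ` {S. indep_set H S})"
    using F by simp
  show "y \<le> M" if "y \<in> card ` {S. indep_set H S}" for y
    using that F(3) card_mono unfolding indep_iff by fastforce
  show "M \<in> card ` {S. indep_set H S}"
    using F(2,3) unfolding indep_iff by blast
qed

lemma coeff_indep_poly: "k \<le> M \<Longrightarrow> coeff (indep_poly H) k = card (faces F k)"
  by (simp add: indep_poly_def indep_number_eq num_indep_sets_eq_card_faces coeff_sum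
      coeff_monom if_distrib sum.delta cong: if_cong)

text \<open>\<open>coeffs\<close> strips trailing zeros, so its length depends on the coefficient at
  \<open>M\<close> being nonzero; any generator witnesses this.\<close>

lemma degree_indep_poly: "degree (indep_poly H) = M"
proof (rule antisym)
  show "degree (indep_poly H) \<le> M"
    unfolding indep_poly_def indep_number_eq
    by (intro degree_sum_le) (auto intro: order_trans[OF degree_monom_le])
  obtain X where "X \<in> F" using F(2) by blast
  then have "X \<in> faces F M" using F(3) by (auto simp: faces_def)
  then have "card (faces F M) \<noteq> 0"
    using F finite_faces by (metis card_eq_0_iff empty_iff)
  then show "M \<le> degree (indep_poly H)"
    by (intro le_degree) (simp add: coeff_indep_poly)
qed

lemma unimodal_indep_poly:
  assumes "\<And>k. 2 * Suc k \<le> Suc M \<Longrightarrow> card (faces F k) \<le> card (faces F (Suc k))"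
    and "\<And>k. M \<le> 2 * k \<Longrightarrow> k < M \<Longrightarrow> card (faces F (Suc k)) \<le> card (faces F k)"
  shows "unimodal (coeffs (indep_poly H))"
proof -
  \<comment> \<open>For \<open>M = 0\<close> the degree alone does not exclude the zero polynomial,
    whose coefficient list is empty; the empty independent set does, through coefficient
    \<open>0\<close>.\<close>
  obtain X where "X \<in> F" using F(2) by blast
  then have "{} \<in> faces F 0" by (auto simp: faces_def)
  then have "coeff (indep_poly H) 0 \<noteq> 0"
    using F finite_faces by (metis card_eq_0_iff coeff_indep_poly empty_iff le0)
  then have "indep_poly H \<noteq> 0" by auto
  then have len: "length (coeffs (indep_poly H)) = Suc M"
    by (simp add: length_coeffs_degree degree_indep_poly)
  have nth: "coeffs (indep_poly H) ! k = card (faces F k)" if "k \<le> M" for k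
    using that \<open>indep_poly H \<noteq> 0\<close> coeff_indep_poly degree_indep_poly
    by (simp add: coeffs_nth)
  show ?thesis
    unfolding unimodal_def len
    \<comment> \<open>Below the peak \<open>(M + 1) div 2\<close> one has
      \<open>2 * Suc k \<le> Suc M\<close>, and from it on \<open>M \<le> 2 * k\<close>, for either
      parity of \<open>M\<close>.\<close>
    using assms by (intro exI[of _ "(M + 1) div 2"]) (auto simp: nth)
qed

end

section \<open>Relabelling the vertices of a graph\<close>

text \<open>Serves to move the blow-up from triples to natural numbers and to describe the copy of
  \<open>G\<close> inside it.\<close>

definition relabel :: "('a \<Rightarrow> 'b) \<Rightarrow> 'a pair_pre_digraph \<Rightarrow> 'b pair_pre_digraph" where
  "relabel c G = \<lparr>pverts = c ` pverts G, parcs = map_prod c c ` parcs G\<rparr>"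

lemma pair_graph_relabel:
  assumes "pair_graph G" "inj_on c (pverts G)"
  shows "pair_graph (relabel c G)"
proof -
  interpret pair_graph G by fact
  show ?thesis
  proof
    show "finite (pverts (relabel c G))" "finite (parcs (relabel c G))"
      by (simp_all add: relabel_def)
    show "symmetric (with_proj (relabel c G))"
      using pair_sym_arcs
      by (fastforce simp: symmetric_def relabel_def sym_def)
    fix e assume "e \<in> parcs (relabel c G)"
    then obtain u v where e: "(u, v) \<in> parcs G" "e = (c u, c v)"
      by (auto simp: relabel_def)
    then have "u \<noteq> v" "u \<in> pverts G" "v \<in> pverts G"
      using pair_no_loops arc_fst_in_verts arc_snd_in_verts by fastforce+
    then show "fst e \<in> pverts (relabel c G)" "snd e \<in> pverts (relabel c G)" "fst e \<noteq> snd e"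
      using e assms(2) by (auto simp: relabel_def inj_on_def)
  qed
qed

lemma digraph_iso_relabel:
  assumes "pair_graph G" "inj_on c (pverts G)"
  shows "digraph_iso (with_proj G) (with_proj (relabel c G))"
proof -
  interpret pair_graph G by fact
  \<comment> \<open>Arcs of \<open>with_proj\<close> are pairs of vertices, so the arc map is
    induced by \<open>c\<close> and the new tail and head are again the projections.\<close>
  let ?f = "\<lparr>iso_verts = c, iso_arcs = map_prod c c, iso_head = snd, iso_tail = fst\<rparr>"
  have "inj_on (map_prod c c) (parcs G)"
    by (rule inj_on_subset[OF map_prod_inj_on[OF assms(2,2)]])
      (auto dest: arc_fst_in_verts arc_snd_in_verts)
  then have "pre_digraph.digraph_isomorphism (with_proj G) ?f"
    using assms(2) wf_digraph_axioms by (auto simp: pre_digraph.digraph_isomorphism_def)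
  moreover have "with_proj (relabel c G) = app_iso ?f (with_proj G)"
    by (simp add: app_iso_def relabel_def with_proj_def)
  ultimately show ?thesis unfolding digraph_iso_def by blast
qed

lemma indep_set_relabel:
  assumes "pair_graph G" "inj_on c (pverts G)"
  shows "indep_set (relabel c G) S \<longleftrightarrow> (\<exists>S'. indep_set G S' \<and> S = c ` S')"
proof
  assume S: "indep_set (relabel c G) S"
  then obtain S' where S': "S' \<subseteq> pverts G" "S = c ` S'"
    unfolding indep_set_def relabel_def by (auto simp: subset_image_iff)
  have "indep_set G S'"
    using S S' by (force simp: indep_set_def relabel_def)
  with S' show "\<exists>S'. indep_set G S' \<and> S = c ` S'" by blast
next
  interpret pair_graph G by fact
  assume "\<exists>S'. indep_set G S' \<and> S = c ` S'"
  then obtain S' where S': "indep_set G S'" "S = c ` S'" by blast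
  have "(c u, c v) \<notin> map_prod c c ` parcs G" if "u \<in> S'" "v \<in> S'" for u v
  proof
    assume "(c u, c v) \<in> map_prod c c ` parcs G"
    then obtain a b where "(a, b) \<in> parcs G" "c a = c u" "c b = c v" by auto
    moreover from this have "a = u" "b = v"
      using assms(2) S' that by (auto simp: indep_set_def inj_on_def dest: in_arcsD1 in_arcsD2)
    ultimately show False using S' that by (auto simp: indep_set_def)
  qed
  with S' show "indep_set (relabel c G) S"
    by (auto simp: indep_set_def relabel_def)
qed

section \<open>The blow-up of the corona and its maximal independent sets\<close>

text \<open>
  The flag \<open>True\<close> marks the copies of the vertices of \<open>G\<close>, \<open>False\<close> those of the pendant vertices.
\<close>

definition blowup :: "'a pair_pre_digraph \<Rightarrow> nat \<Rightarrow> ('a \<times> bool \<times> nat) pair_pre_digraph" where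
  "blowup G r = \<lparr>pverts = pverts G \<times> UNIV \<times> {..<r},
     parcs = {((v, b, i), (w, b', j)). v \<in> pverts G \<and> w \<in> pverts G \<and> i < r \<and> j < r \<and>
       (v = w \<and> b \<noteq> b' \<or> b \<and> b' \<and> (v, w) \<in> parcs G)}\<rparr>"

text \<open>The truth value of \<open>v \<in> T\<close> serves as the flag, so every vertex
  contributes exactly one side of its \<open>K_{r,r}\<close>.\<close>

definition facet :: "'a pair_pre_digraph \<Rightarrow> nat \<Rightarrow> 'a set \<Rightarrow> ('a \<times> bool \<times> nat) set" where
  "facet G r T = (\<lambda>(v, i). (v, v \<in> T, i)) ` (pverts G \<times> {..<r})"

lemma pair_graph_blowup:
  assumes "pair_graph G"
  shows "pair_graph (blowup G r)"
proof -
  interpret pair_graph G by fact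
  have sym: "(w, v) \<in> parcs G" if "(v, w) \<in> parcs G" for v w
    using that pair_sym_arcs by (auto simp: symmetric_def dest: symD)
  have irrefl: "(v, v) \<notin> parcs G" for v
    using pair_no_loops by fastforce
  have sub: "parcs (blowup G r) \<subseteq> pverts (blowup G r) \<times> pverts (blowup G r)"
    by (auto simp: blowup_def)
  show ?thesis
  proof
    show fin: "finite (pverts (blowup G r))"
      by (simp add: blowup_def)
    show "finite (parcs (blowup G r))"
      using finite_subset[OF sub] fin by blast
    show "symmetric (with_proj (blowup G r))"
      unfolding symmetric_def by (auto intro!: symI simp: blowup_def sym)
    fix e assume "e \<in> parcs (blowup G r)"
    then show "fst e \<in> pverts (blowup G r)" "snd e \<in> pverts (blowup G r)" "fst e \<noteq> snd e"
      by (auto simp: blowup_def irrefl)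
  qed
qed

lemma card_facet: "card (facet G r T) = card (pverts G) * r"
  unfolding facet_def by (subst card_image) (auto simp: inj_on_def card_cartesian_product)

text \<open>At a vertex where \<open>T\<close> and \<open>T'\<close> disagree the flags differ, so
  none of its \<open>r\<close> copies is shared.\<close>

lemma card_facet_Int:
  assumes "finite (pverts G)" "T \<subseteq> pverts G" "T' \<subseteq> pverts G" "T \<noteq> T'"
  shows "card (facet G r T \<inter> facet G r T') \<le> (card (pverts G) - 1) * r"
proof -
  obtain v where v: "v \<in> pverts G" "v \<in> T \<longleftrightarrow> v \<notin> T'"
    using assms by blast
  have "facet G r T \<inter> facet G r T' \<subseteq> (\<lambda>(v, i). (v, v \<in> T, i)) ` ((pverts G - {v}) \<times> {..<r})"
    using v(2) by (auto simp: facet_def)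
  then have "card (facet G r T \<inter> facet G r T') \<le> card ((pverts G - {v}) \<times> {..<r})"
    using assms(1) by (meson card_image_le card_mono finite_Diff finite_SigmaI finite_imageI
        finite_lessThan order_trans)
  then show ?thesis
    using v(1) assms(1) by (simp add: card_cartesian_product)
qed

text \<open>Let \<open>T\<close> collect the vertices with a \<open>True\<close> copy in
  \<open>S\<close>. Arcs between \<open>True\<close> copies make \<open>T\<close> independent, and
  the complete bipartite graph at each vertex keeps \<open>S\<close> on a single side there.
  Conversely, the facet of an independent \<open>T\<close> has no arcs.\<close>

lemma indep_set_blowup:
  assumes "pair_graph G"
  shows "indep_set (blowup G r) S \<longleftrightarrow> (\<exists>T. indep_set G T \<and> S \<subseteq> facet G r T)"
proof
  interpret pair_graph G by fact
  assume S: "indep_set (blowup G r) S"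
  define T where "T = {v. \<exists>i. (v, True, i) \<in> S}"
  have nonadj: "\<not> (v = w \<and> b \<noteq> b' \<or> b \<and> b' \<and> (v, w) \<in> parcs G)" and
    vert: "v \<in> pverts G" "i < r"
    if "(v, b, i) \<in> S" "(w, b', j) \<in> S" for v w b b' i j
    using S that unfolding indep_set_def blowup_def by fastforce+
  have "indep_set G T"
    using nonadj vert unfolding indep_set_def T_def by blast
  moreover have "S \<subseteq> facet G r T"
  proof
    fix p assume "p \<in> S"
    obtain v b i where p: "p = (v, b, i)" by (cases p)
    have "b \<longleftrightarrow> v \<in> T"
    proof
      assume "v \<in> T"
      then obtain j where "(v, True, j) \<in> S" by (auto simp: T_def)
      then show b using nonadj[of v b i v True j] \<open>p \<in> S\<close> p by simp
    qed (use \<open>p \<in> S\<close> p in \<open>auto simp: T_def\<close>)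
    then show "p \<in> facet G r T"
      using vert \<open>p \<in> S\<close> p by (auto simp: facet_def)
  qed
  ultimately show "\<exists>T. indep_set G T \<and> S \<subseteq> facet G r T" by blast
next
  assume "\<exists>T. indep_set G T \<and> S \<subseteq> facet G r T"
  then obtain T where T: "indep_set G T" "S \<subseteq> facet G r T" by blast
  then have "indep_set (blowup G r) (facet G r T)"
    by (auto simp: indep_set_def blowup_def facet_def)
  with T(2) show "indep_set (blowup G r) S"
    by (auto simp: indep_set_def)
qed

section \<open>The relabelled blow-up and the copy of \<open>G\<close> inside it\<close>

theorem corollary2p5:
  fixes G :: "'a pair_pre_digraph" and n :: nat
  assumes "pair_graph G" and "card (pverts G) = n"
  shows "\<exists>(H :: nat pair_pre_digraph) (F :: nat pair_pre_digraph).
           pair_graph H \<and>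
           very_well_covered H \<and>
           unimodal (coeffs (indep_poly H)) \<and>
           induced_subgraph (with_proj F) (with_proj H) \<and>
           digraph_iso (with_proj G) (with_proj F)"
proof -
  interpret pair_graph G by fact
  define I where "I = {T. indep_set G T}"
  have I_sub: "T \<subseteq> pverts G" if "T \<in> I" for T
    using that by (simp add: I_def indep_set_def)
  then have "finite I"
    using finite_subset[of I "Pow (pverts G)"] by auto
  have "{} \<in> I" by (simp add: I_def indep_set_def)
  \<comment> \<open>For the empty graph any positive \<open>r\<close> serves, because the descending
    range \<open>k < n * r\<close> is then empty.\<close>
  obtain r where "r > 0" and gap:
    "n = 0 \<or> (\<forall>k. n * r \<le> 2 * k \<longrightarrow> card I * Suc k * ((n - 1) * r choose k) \<le> (n * r choose k))"
    using exists_blowup_factor[of n "card I"] by (cases "n = 0") auto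
  define B where "B = blowup G r"
  have B: "pair_graph B"
    using assms(1) by (simp add: B_def pair_graph_blowup)
  have verts_B: "pverts B = pverts G \<times> UNIV \<times> {..<r}"
    by (simp add: B_def blowup_def)
  then have "finite (pverts B)" by simp
  then obtain c :: "'a \<times> bool \<times> nat \<Rightarrow> nat" where inj: "inj_on c (pverts B)"
    using finite_imp_inj_to_nat_seg by blast
  define H where "H = relabel c B"
  \<comment> \<open>The copy of \<open>G\<close> consists of the \<open>True\<close> copies of index
    \<open>0\<close>, which exist because \<open>r > 0\<close>.\<close>
  define F where "F = relabel (\<lambda>v. c (v, True, 0)) G"
  define \<F> where "\<F> = (\<lambda>T. c ` facet G r T) ` I"
  have facet_sub: "facet G r T \<subseteq> pverts B" for T
    by (auto simp: facet_def verts_B)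
  have indep: "indep_set H S \<longleftrightarrow> (\<exists>X\<in>\<F>. S \<subseteq> X)" for S
  proof -
    have "indep_set H S \<longleftrightarrow> (\<exists>S' T. indep_set G T \<and> S' \<subseteq> facet G r T \<and> S = c ` S')"
      unfolding H_def indep_set_relabel[OF B inj] unfolding B_def indep_set_blowup[OF assms(1)]
      by blast
    then show ?thesis
      by (auto simp: \<F>_def I_def subset_image_iff)
  qed
  have "finite \<F>" "\<F> \<noteq> {}"
    using \<open>finite I\<close> \<open>{} \<in> I\<close> by (auto simp: \<F>_def)
  have card_\<F>: "card \<F> \<le> card I"
    unfolding \<F>_def by (rule card_image_le) fact
  have facets: "finite X \<and> card X = n * r" if "X \<in> \<F>" for X
  proof -
    obtain T where "X = c ` facet G r T" using \<open>X \<in> \<F>\<close> unfolding \<F>_def by blast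
    then show ?thesis
      using card_image[OF inj_on_subset[OF inj facet_sub]] card_facet[of G r T] assms(2)
        finite_subset[OF facet_sub \<open>finite (pverts B)\<close>] by simp
  qed
  have overlap: "card (X \<inter> Y) \<le> (n - 1) * r" if XY: "X \<in> \<F>" "Y \<in> \<F>" "X \<noteq> Y" for X Y
  proof -
    obtain T T' where T: "X = c ` facet G r T" "Y = c ` facet G r T'" "T \<in> I" "T' \<in> I" "T \<noteq> T'"
      using XY by (auto simp: \<F>_def)
    have "X \<inter> Y = c ` (facet G r T \<inter> facet G r T')"
      unfolding T using inj_on_image_Int[OF inj facet_sub facet_sub] by simp
    then have "card (X \<inter> Y) \<le> card (facet G r T \<inter> facet G r T')"
      using finite_subset[OF facet_sub \<open>finite (pverts B)\<close>] by (simp add: card_image_le)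
    also have "\<dots> \<le> (n - 1) * r"
      using card_facet_Int[of G T T' r] T I_sub assms(2) by simp
    finally show ?thesis .
  qed
  have "unimodal (coeffs (indep_poly H))"
  proof (rule unimodal_indep_poly[OF indep \<open>finite \<F>\<close> \<open>\<F> \<noteq> {}\<close> facets])
    fix k assume "2 * Suc k \<le> Suc (n * r)"
    then show "card (faces \<F> k) \<le> card (faces \<F> (Suc k))"
      using card_faces_incr[OF \<open>finite \<F>\<close> facets] by blast
  next
    fix k assume k: "n * r \<le> 2 * k" "k < n * r"
    then have "card I * Suc k * ((n - 1) * r choose k) \<le> (n * r choose k)"
      using gap by auto
    \<comment> \<open>The factor \<open>r\<close> was chosen for \<open>card I\<close>; the
      inequality passes to the number of facets, which is no larger.\<close>
    moreover have "card \<F> * Suc k * ((n - 1) * r choose k) \<le> card I * Suc k * ((n - 1) * r choose k)"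
      using card_\<F> by (intro mult_right_mono) auto
    ultimately have "card \<F> * Suc k * ((n - 1) * r choose k) \<le> (n * r choose k)"
      by (rule order_trans[rotated])
    then show "card (faces \<F> (Suc k)) \<le> card (faces \<F> k)"
      using k by (intro card_faces_decr[OF \<open>finite \<F>\<close> facets overlap]) auto
  qed
  moreover have "very_well_covered H"
  proof -
    \<comment> \<open>The factor \<open>2\<close> comes from the two flags, of which each facet uses
      one per vertex of \<open>G\<close>.\<close>
    have "card (pverts H) = 2 * (n * r)"
      using card_image[OF inj] assms(2)
      by (simp add: H_def relabel_def verts_B card_cartesian_product)
    then show ?thesis
      using card_maximal_indep_set[OF indep \<open>finite \<F>\<close> \<open>\<F> \<noteq> {}\<close> facets]
      by (auto simp: very_well_covered_def)
  qed
  moreover have H: "pair_graph H"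
    unfolding H_def by (rule pair_graph_relabel[OF B inj])
  moreover have inj0: "inj_on (\<lambda>v. c (v, True, 0)) (pverts G)"
    using inj \<open>r > 0\<close> by (auto simp: inj_on_def verts_B)
  then have F: "pair_graph F" and "digraph_iso (with_proj G) (with_proj F)"
    unfolding F_def using assms(1) by (auto intro: pair_graph_relabel digraph_iso_relabel)
  moreover have "induced_subgraph (with_proj F) (with_proj H)"
  proof -
    interpret F: pair_graph F by (rule F)
    interpret H: pair_graph H by (rule H)
    have verts_F: "pverts F \<subseteq> pverts H"
      using \<open>r > 0\<close> by (auto simp: F_def H_def relabel_def verts_B)
    have "e \<in> parcs F \<longleftrightarrow> e \<in> parcs H \<and> fst e \<in> pverts F \<and> snd e \<in> pverts F" for e
    proof
      assume "e \<in> parcs F"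
      then obtain u v where uv: "(u, v) \<in> parcs G" "e = (c (u, True, 0), c (v, True, 0))"
        by (auto simp: F_def relabel_def)
      then have "((u, True, 0), (v, True, 0)) \<in> parcs B"
        using \<open>r > 0\<close> by (auto simp: B_def blowup_def dest: in_arcsD1 in_arcsD2)
      then have "e \<in> parcs H"
        using uv by (force simp: H_def relabel_def)
      with \<open>e \<in> parcs F\<close> show "e \<in> parcs H \<and> fst e \<in> pverts F \<and> snd e \<in> pverts F"
        using F.arc_fst_in_verts F.arc_snd_in_verts by blast
    next
      assume e: "e \<in> parcs H \<and> fst e \<in> pverts F \<and> snd e \<in> pverts F"
      then obtain p q where pq: "(p, q) \<in> parcs B" "e = (c p, c q)"
        by (auto simp: H_def relabel_def)
      obtain u v where uv: "u \<in> pverts G" "v \<in> pverts G" "c p = c (u, True, 0)" "c q = c (v, True, 0)"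
        using e pq by (auto simp: F_def relabel_def)
      have "p \<in> pverts B" "q \<in> pverts B"
        using pq by (auto simp: B_def blowup_def)
      moreover have "(u, True, 0) \<in> pverts B" "(v, True, 0) \<in> pverts B"
        using uv \<open>r > 0\<close> by (auto simp: verts_B)
      ultimately have "p = (u, True, 0)" "q = (v, True, 0)"
        using uv by (simp_all add: inj_on_eq_iff[OF inj])
      \<comment> \<open>Both flags are \<open>True\<close>, which rules out the arcs of the complete
        bipartite graphs and leaves only an arc of \<open>G\<close>.\<close>
      then have "(u, v) \<in> parcs G" "e = map_prod (\<lambda>v. c (v, True, 0)) (\<lambda>v. c (v, True, 0)) (u, v)"
        using pq by (auto simp: B_def blowup_def)
      then show "e \<in> parcs F"
        unfolding F_def relabel_def pair_pre_digraph.simps by (rule rev_image_eqI)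
    qed
    then have arcs_F: "parcs F = {e \<in> parcs H. fst e \<in> pverts F \<and> snd e \<in> pverts F}"
      by blast
    then have "parcs F \<subseteq> parcs H" by blast
    with verts_F have "subgraph (with_proj F) (with_proj H)"
      unfolding subgraph_def compatible_def with_proj_simps
      by (intro conjI refl H.wf_digraph_axioms F.wf_digraph_axioms)
    with arcs_F show ?thesis
      unfolding induced_subgraph_def with_proj_simps by (rule conjI[rotated])
  qed
  ultimately show ?thesis by (intro exI[of _ H] exI[of _ F] conjI)
qed

end
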